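(* Let $G$ be a discrete group and let $G\curvearrowright C(X)$ be the action induced by an extremely proximal, topologically free action of $G$ on a compact Hausdorff space $X$ with $|X|>2$. Then $G\curvearrowright C(X)$ has the $\mathrm{PHP}$ property with respect to any state $\phi$ on $C(X)$. Furthermore, if the restriction of the action to a subgroup $K\le G$ is still extremely proximal, then the action $G\curvearrowright C(X)$ has the $\mathrm{PHP}$ property relative to $K$ with respect to any state $\phi$ on $C(X)$.
   Context: An action $G\curvearrowright X$ by homeomorphisms on a compact Hausdorff space $X$ with $|X|>2$ is extremely proximal if for every pair of non-empty open subsets $U,V\subseteq X$ there exists $g\in G$ with $g(X\setminus U)\subseteq V$. It is topologically free if for every $g\neq e$ the fixed point set of $g$ has empty interior. The induced action on $C(X)$ is $\alpha_g(f)(x)=f(g^{-1}x)$. $\mathrm{PHP}$ property. Let $G$ be a discrete group, $A$ a unital $\mathrm{C}^*$-algebra and $\phi$ a state on $A$. A map $\alpha\colon G\to\mathrm{Aut}(A)$ has the $\mathrm{PHP}$ property with respect to $\phi$ if for every finite $F_A\subseteq A$, finite $F_G\subseteq G$, $N\in\mathbb{N}$ and $\varepsilon>0$, there exist $n\ge N$, $t_i\in G$ and $C_i\subseteq D_i\subseteq G$ for $1\le i\le n$ such that: (i) the subsets $\{gC_i: g\in F_G,\ i=1,\dots,n\}\cup\{ht_j^{-1}(G\setminus D_j): h\in F_G,\ j=1,\dots,n\}$ (as a family indexed by the pairs $(g,i)$ and $(h,j)$) are pairwise disjoint; (ii) $\sup_{g\in G}|\{i: g\in D_i\}\cup\{j: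 g\in t_j^{-1}(G\setminus C_j)\}|\le\varepsilon n^{1/2}$; (iii) $\max_{a\in F_A}\big\|\frac{1}{2n}\sum_{i=1}^n(\alpha_{t_i}(a)+\alpha_{t_i}^{-1}(a))-\phi(a)1_A\big\|<\varepsilon$. If moreover the elements $t_1,\dots,t_n$ can always be chosen in a subgroup $K\le G$, then $\alpha$ has the $\mathrm{PHP}$ property relative to $K$ (with respect to $\phi$). *)

theory Defs
  imports "HOL-Analysis.Analysis" "HOL-Algebra.Group_Action"
begin

subsection \<open>Unital C*-algebras\<close>

text \<open>The norm of the unit is required to be 1, which excludes only the zero algebra; that algebra
  has no states.\<close>

class unital_cstar_algebra = banach + real_normed_algebra_1 +
  fixes scaleC :: "complex \<Rightarrow> 'a \<Rightarrow> 'a"  (infixr \<open>*\<^sub>C\<close> 75)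
    and adj :: "'a \<Rightarrow> 'a"
  assumes scaleC_add_right: "c *\<^sub>C (a + b) = c *\<^sub>C a + c *\<^sub>C b"
    and scaleC_add_left: "(c + d) *\<^sub>C a = c *\<^sub>C a + d *\<^sub>C a"
    and scaleC_scaleC: "c *\<^sub>C d *\<^sub>C a = (c * d) *\<^sub>C a"
    and scaleC_of_real: "complex_of_real r *\<^sub>C a = r *\<^sub>R a"
    and mult_scaleC_left: "(c *\<^sub>C a) * b = c *\<^sub>C (a * b)"
    and mult_scaleC_right: "a * (c *\<^sub>C b) = c *\<^sub>C (a * b)"
    and norm_scaleC: "norm (c *\<^sub>C a) = cmod c * norm a"
    and adj_adj: "adj (adj a) = a"
    and adj_add: "adj (a + b) = adj a + adj b"
    and adj_scaleC: "adj (c *\<^sub>C a) = cnj c *\<^sub>C adj a"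
    and adj_mult: "adj (a * b) = adj b * adj a"
    and cstar_identity: "norm (adj a * a) = (norm a)\<^sup>2"

definition star_automorphism :: "('a::unital_cstar_algebra \<Rightarrow> 'a) \<Rightarrow> bool" where
  "star_automorphism f \<longleftrightarrow> bij f \<and>
     (\<forall>a b. f (a + b) = f a + f b) \<and> (\<forall>c a. f (c *\<^sub>C a) = c *\<^sub>C f a) \<and>
     (\<forall>a b. f (a * b) = f a * f b) \<and> (\<forall>a. f (adj a) = adj (f a))"

definition state :: "('a::unital_cstar_algebra \<Rightarrow> complex) \<Rightarrow> bool" where
  "state \<phi> \<longleftrightarrow> (\<forall>a b. \<phi> (a + b) = \<phi> a + \<phi> b) \<and> (\<forall>c a. \<phi> (c *\<^sub>C a) = c * \<phi> a) \<and>
     (\<forall>a. \<phi> (adj a * a) \<in> \<real>\<^sub>\<ge>\<^sub>0) \<and> \<phi> 1 = 1"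

subsection \<open>The PHP property\<close>

text \<open>Disjointness in condition (i) is that of an indexed family: its index set is the disjoint sum
  of two copies of \<open>F\<^sub>G \<times> {1..n}\<close>, so sets with different indices are required to be disjoint even if
  they coincide. The supremum in (ii) is over a nonempty set of reals bounded by \<open>n\<close>.\<close>

definition PHP_witness ::
  "('g, 'm) monoid_scheme \<Rightarrow> ('g \<Rightarrow> 'a::unital_cstar_algebra \<Rightarrow> 'a) \<Rightarrow> ('a \<Rightarrow> complex) \<Rightarrow>
   'a set \<Rightarrow> 'g set \<Rightarrow> real \<Rightarrow> nat \<Rightarrow> (nat \<Rightarrow> 'g) \<Rightarrow> (nat \<Rightarrow> 'g set) \<Rightarrow> (nat \<Rightarrow> 'g set) \<Rightarrow> bool"
  where
  "PHP_witness G \<alpha> \<phi> F\<^sub>A F\<^sub>G \<epsilon> n t C D \<longleftrightarrow>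
     (\<forall>i\<in>{1..n}. t i \<in> carrier G \<and> C i \<subseteq> D i \<and> D i \<subseteq> carrier G) \<and>
     disjoint_family_on
       (case_sum (\<lambda>(g, i). g <#\<^bsub>G\<^esub> C i)
                 (\<lambda>(h, j). (h \<otimes>\<^bsub>G\<^esub> inv\<^bsub>G\<^esub> (t j)) <#\<^bsub>G\<^esub> (carrier G - D j)))
       ((F\<^sub>G \<times> {1..n}) <+> (F\<^sub>G \<times> {1..n})) \<and>
     (SUP g\<in>carrier G. real (card ({i\<in>{1..n}. g \<in> D i} \<union>
         {j\<in>{1..n}. g \<in> inv\<^bsub>G\<^esub> (t j) <#\<^bsub>G\<^esub> (carrier G - C j)}))) \<le> \<epsilon> * sqrt (real n) \<and>
     (\<forall>a\<in>F\<^sub>A. norm ((1 / (2 * real n)) *\<^sub>R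
         (\<Sum>i=1..n. \<alpha> (t i) a + inv_into UNIV (\<alpha> (t i)) a) - \<phi> a *\<^sub>C 1) < \<epsilon>)"

definition PHP ::
  "('g, 'm) monoid_scheme \<Rightarrow> ('g \<Rightarrow> 'a::unital_cstar_algebra \<Rightarrow> 'a) \<Rightarrow> ('a \<Rightarrow> complex) \<Rightarrow> bool"
  where
  "PHP G \<alpha> \<phi> \<longleftrightarrow> group G \<and> (\<forall>g\<in>carrier G. star_automorphism (\<alpha> g)) \<and> state \<phi> \<and>
     (\<forall>F\<^sub>A F\<^sub>G N \<epsilon>. finite F\<^sub>A \<and> finite F\<^sub>G \<and> F\<^sub>G \<subseteq> carrier G \<and> \<epsilon> > 0 \<longrightarrow>
        (\<exists>n\<ge>N. \<exists>t C D. PHP_witness G \<alpha> \<phi> F\<^sub>A F\<^sub>G \<epsilon> n t C D))"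

definition PHP_relative ::
  "('g, 'm) monoid_scheme \<Rightarrow> 'g set \<Rightarrow> ('g \<Rightarrow> 'a::unital_cstar_algebra \<Rightarrow> 'a) \<Rightarrow>
   ('a \<Rightarrow> complex) \<Rightarrow> bool"
  where
  "PHP_relative G K \<alpha> \<phi> \<longleftrightarrow>
     group G \<and> subgroup K G \<and> (\<forall>g\<in>carrier G. star_automorphism (\<alpha> g)) \<and> state \<phi> \<and>
     (\<forall>F\<^sub>A F\<^sub>G N \<epsilon>. finite F\<^sub>A \<and> finite F\<^sub>G \<and> F\<^sub>G \<subseteq> carrier G \<and> \<epsilon> > 0 \<longrightarrow>
        (\<exists>n\<ge>N. \<exists>t C D. PHP_witness G \<alpha> \<phi> F\<^sub>A F\<^sub>G \<epsilon> n t C D \<and> (\<forall>i\<in>{1..n}. t i \<in> K)))"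

subsection \<open>Actions on topological spaces\<close>

definition topological_action ::
  "('g, 'm) monoid_scheme \<Rightarrow> ('g \<Rightarrow> 'x::topological_space \<Rightarrow> 'x) \<Rightarrow> bool" where
  "topological_action G \<sigma> \<longleftrightarrow> group_action G UNIV \<sigma> \<and>
     (\<forall>g\<in>carrier G. homeomorphism UNIV UNIV (\<sigma> g) (\<sigma> (inv\<^bsub>G\<^esub> g)))"

definition extremely_proximal ::
  "('g, 'm) monoid_scheme \<Rightarrow> ('g \<Rightarrow> 'x::topological_space \<Rightarrow> 'x) \<Rightarrow> bool" where
  "extremely_proximal G \<sigma> \<longleftrightarrow>
     (\<forall>U V. open U \<and> open V \<and> U \<noteq> {} \<and> V \<noteq> {} \<longrightarrow> (\<exists>g\<in>carrier G. \<sigma> g ` (UNIV - U) \<subseteq> V))"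

definition topologically_free ::
  "('g, 'm) monoid_scheme \<Rightarrow> ('g \<Rightarrow> 'x::topological_space \<Rightarrow> 'x) \<Rightarrow> bool" where
  "topologically_free G \<sigma> \<longleftrightarrow>
     (\<forall>g\<in>carrier G. g \<noteq> \<one>\<^bsub>G\<^esub> \<longrightarrow> interior {x. \<sigma> g x = x} = {})"

subsection \<open>The C*-algebra of continuous functions\<close>

text \<open>The type \<open>'x \<Rightarrow>\<^sub>C complex\<close> of bounded continuous functions with the supremum norm is \<open>C(X)\<close> when
  \<open>X\<close> is compact. The pointwise structure is set up for values in any unital C*-algebra because type
  class instances need a class constraint on the value type.\<close>

lemma continuous_in_bcontfun:
  fixes f :: "'x::topological_space \<Rightarrow> 'b::metric_space"
  assumes "compact (UNIV :: 'x set)" "continuous_on UNIV f"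
  shows "f \<in> bcontfun"
  using assms compact_continuous_image compact_imp_bounded by (auto simp: bcontfun_def)

text \<open>The library has completeness only for functions on metric spaces.\<close>

instance bcontfun :: (topological_space, complete_space) complete_space
proof
  fix f :: "nat \<Rightarrow> ('a, 'b) bcontfun"
  assume "Cauchy f"
  then obtain g where "uniform_limit UNIV f g sequentially"
    using uniformly_convergent_eq_cauchy[of "\<lambda>_. True" f]
    unfolding Cauchy_def uniform_limit_sequentially_iff
    by (metis dist_fun_lt_imp_dist_val_lt)
  from uniform_limit_bcontfunE[OF this sequentially_bot]
  obtain l' where "g = apply_bcontfun l'" "(f \<longlonglongrightarrow> l')" by metis
  then show "convergent f"
    by (intro convergentI)
qed

instance bcontfun :: (topological_space, banach) banach ..

instantiation complex :: unital_cstar_algebra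
begin

definition scaleC_complex :: "complex \<Rightarrow> complex \<Rightarrow> complex" where [simp]: "scaleC_complex c z = c * z"
definition adj_complex :: "complex \<Rightarrow> complex" where [simp]: "adj_complex z = cnj z"

instance
  by standard (auto simp: algebra_simps norm_mult scaleR_conv_of_real power2_eq_square)

end

lemma norm_adj: "norm (adj a) = norm (a :: 'a::unital_cstar_algebra)"
proof -
  have le: "norm b \<le> norm (adj b)" for b :: 'a
    using norm_mult_ineq[of "adj b" b] cstar_identity[of b]
    by (cases "b = 0") (auto simp: power2_eq_square)
  show ?thesis using le[of a] le[of "adj a"] by (simp add: adj_adj)
qed

lemma bounded_linear_scaleC: "bounded_linear (\<lambda>a :: 'a::unital_cstar_algebra. c *\<^sub>C a)"
proof (rule bounded_linear_intro[where K = "cmod c"])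
  fix r and a :: 'a
  have "c *\<^sub>C (r *\<^sub>R a) = (c * complex_of_real r) *\<^sub>C a"
    by (simp only: scaleC_of_real[symmetric] scaleC_scaleC)
  also have "\<dots> = r *\<^sub>R (c *\<^sub>C a)"
    by (simp only: scaleC_of_real[symmetric] scaleC_scaleC mult.commute)
  finally show "c *\<^sub>C (r *\<^sub>R a) = r *\<^sub>R (c *\<^sub>C a)" .
qed (simp_all add: scaleC_add_right norm_scaleC)

lemma bounded_linear_adj: "bounded_linear (adj :: 'a::unital_cstar_algebra \<Rightarrow> 'a)"
proof (rule bounded_linear_intro[where K = 1])
  fix r and a :: 'a
  show "adj (r *\<^sub>R a) = r *\<^sub>R adj a"
    by (simp add: scaleC_of_real[symmetric] adj_scaleC)
qed (simp_all add: adj_add norm_adj)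

lemma bcontfun_bounded_linear:
  assumes "bounded_linear h" "f \<in> bcontfun"
  shows "(\<lambda>x. h (f x)) \<in> bcontfun"
  using assms bounded_linear_image[of "range f" h]
  by (auto simp: bcontfun_def image_image intro: bounded_linear.continuous_on)

setup_lifting type_definition_bcontfun

instantiation bcontfun :: (topological_space, unital_cstar_algebra) unital_cstar_algebra
begin

lift_definition one_bcontfun :: "('a, 'b) bcontfun" is "\<lambda>_. 1"
  by (rule const_bcontfun)

lift_definition times_bcontfun :: "('a, 'b) bcontfun \<Rightarrow> ('a, 'b) bcontfun \<Rightarrow> ('a, 'b) bcontfun"
  is "\<lambda>f g x. f x * g x"
proof -
  fix f g :: "'a \<Rightarrow> 'b"
  assume f: "f \<in> bcontfun" and g: "g \<in> bcontfun"
  obtain B where B: "\<And>x. norm (f x) \<le> B"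
    using f by (auto simp: bcontfun_def bounded_iff)
  obtain B' where B': "\<And>x. norm (g x) \<le> B'"
    using g by (auto simp: bcontfun_def bounded_iff)
  show "(\<lambda>x. f x * g x) \<in> bcontfun"
  proof (rule bcontfun_normI)
    show "continuous_on UNIV (\<lambda>x. f x * g x)"
      using f g by (auto simp: bcontfun_def intro!: continuous_intros)
    show "norm (f x * g x) \<le> B * B'" for x
      using norm_mult_ineq[of "f x" "g x"] mult_mono[OF B[of x] B'[of x]] norm_ge_zero[of "f x"] B[of x]
      by (meson norm_ge_zero order_trans)
  qed
qed

lift_definition scaleC_bcontfun :: "complex \<Rightarrow> ('a, 'b) bcontfun \<Rightarrow> ('a, 'b) bcontfun"
  is "\<lambda>c f x. c *\<^sub>C f x"
  by (rule bcontfun_bounded_linear[OF bounded_linear_scaleC])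

lift_definition adj_bcontfun :: "('a, 'b) bcontfun \<Rightarrow> ('a, 'b) bcontfun"
  is "\<lambda>f x. adj (f x)"
  by (rule bcontfun_bounded_linear[OF bounded_linear_adj])

lemmas [simp] =
  one_bcontfun.rep_eq times_bcontfun.rep_eq scaleC_bcontfun.rep_eq adj_bcontfun.rep_eq

instance
proof
  fix a b c :: "('a, 'b) bcontfun" and z w :: complex and r :: real
  show "a * b * c = a * (b * c)"
    by (rule bcontfun_eqI) (simp add: mult.assoc)
  show "(a + b) * c = a * c + b * c"
    by (rule bcontfun_eqI) (simp add: distrib_right)
  show "a * (b + c) = a * b + a * c"
    by (rule bcontfun_eqI) (simp add: distrib_left)
  show "r *\<^sub>R a * b = r *\<^sub>R (a * b)"
    by (rule bcontfun_eqI) simp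
  show "a * r *\<^sub>R b = r *\<^sub>R (a * b)"
    by (rule bcontfun_eqI) simp
  show "1 * a = a"
    by (rule bcontfun_eqI) simp
  show "a * 1 = a"
    by (rule bcontfun_eqI) simp
  show "z *\<^sub>C (a + b) = z *\<^sub>C a + z *\<^sub>C b"
    by (rule bcontfun_eqI) (simp add: scaleC_add_right)
  show "(z + w) *\<^sub>C a = z *\<^sub>C a + w *\<^sub>C a"
    by (rule bcontfun_eqI) (simp add: scaleC_add_left)
  show "z *\<^sub>C w *\<^sub>C a = (z * w) *\<^sub>C a"
    by (rule bcontfun_eqI) (simp add: scaleC_scaleC)
  show "complex_of_real r *\<^sub>C a = r *\<^sub>R a"
    by (rule bcontfun_eqI) (simp add: scaleC_of_real)
  show "(z *\<^sub>C a) * b = z *\<^sub>C (a * b)"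
    by (rule bcontfun_eqI) (simp add: mult_scaleC_left)
  show "a * (z *\<^sub>C b) = z *\<^sub>C (a * b)"
    by (rule bcontfun_eqI) (simp add: mult_scaleC_right)
  show "adj (adj a) = a"
    by (rule bcontfun_eqI) (simp add: adj_adj)
  show "adj (a + b) = adj a + adj b"
    by (rule bcontfun_eqI) (simp add: adj_add)
  show "adj (z *\<^sub>C a) = cnj z *\<^sub>C adj a"
    by (rule bcontfun_eqI) (simp add: adj_scaleC)
  show "adj (a * b) = adj b * adj a"
    by (rule bcontfun_eqI) (simp add: adj_mult)
  have "apply_bcontfun (0 :: ('a, 'b) bcontfun) x \<noteq> apply_bcontfun 1 x" for x by simp
  then show "(0 :: ('a, 'b) bcontfun) \<noteq> 1" by metis
  show "norm (a * b) \<le> norm a * norm b"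
  proof (rule norm_bound)
    show "norm (apply_bcontfun (a * b) x) \<le> norm a * norm b" for x
      using norm_mult_ineq[of "a x" "b x"] mult_mono[OF norm_bounded[of a x] norm_bounded[of b x]]
      by simp
  qed
  show "norm (1 :: ('a, 'b) bcontfun) = 1"
  proof (rule antisym)
    show "norm (1 :: ('a, 'b) bcontfun) \<le> 1" by (rule norm_bound) simp
    have "norm (apply_bcontfun (1 :: ('a, 'b) bcontfun) undefined) \<le> norm (1 :: ('a, 'b) bcontfun)"
      by (rule norm_bounded)
    then show "1 \<le> norm (1 :: ('a, 'b) bcontfun)" by simp
  qed
  show "norm (z *\<^sub>C a) = cmod z * norm a"
  proof (rule antisym)
    show "norm (z *\<^sub>C a) \<le> cmod z * norm a"
      by (rule norm_bound) (simp add: norm_scaleC mult_left_mono norm_bounded)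
    show "cmod z * norm a \<le> norm (z *\<^sub>C a)"
    proof (cases "z = 0")
      case False
      have "norm a \<le> norm (z *\<^sub>C a) / cmod z"
      proof (rule norm_bound)
        show "norm (a x) \<le> norm (z *\<^sub>C a) / cmod z" for x
          using norm_bounded[of "z *\<^sub>C a" x] False by (simp add: norm_scaleC field_simps)
      qed
      then show ?thesis using False by (simp add: field_simps)
    qed simp
  qed
  show "norm (adj a * a) = (norm a)\<^sup>2"
  proof (rule antisym)
    show "norm (adj a * a) \<le> (norm a)\<^sup>2"
      by (rule norm_bound) (simp add: cstar_identity power_mono norm_bounded)
    have "norm a \<le> sqrt (norm (adj a * a))"
    proof (rule norm_bound)
      show "norm (a x) \<le> sqrt (norm (adj a * a))" for x
        using norm_bounded[of "adj a * a" x] by (simp add: cstar_identity real_le_rsqrt)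
    qed
    then show "(norm a)\<^sup>2 \<le> norm (adj a * a)"
      using power_mono[of "norm a" "sqrt (norm (adj a * a))" 2] by simp
  qed
qed

end

definition induced_action ::
  "('g, 'm) monoid_scheme \<Rightarrow> ('g \<Rightarrow> 'x::topological_space \<Rightarrow> 'x) \<Rightarrow>
   'g \<Rightarrow> ('x \<Rightarrow>\<^sub>C complex) \<Rightarrow> ('x \<Rightarrow>\<^sub>C complex)" where
  "induced_action G \<sigma> g f = Bcontfun (\<lambda>x. apply_bcontfun f (\<sigma> (inv\<^bsub>G\<^esub> g) x))"

lemma apply_induced_action:
  assumes "topological_action G \<sigma>" "g \<in> carrier G"
  shows "apply_bcontfun (induced_action G \<sigma> g f) x = apply_bcontfun f (\<sigma> (inv\<^bsub>G\<^esub> g) x)"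
proof -
  have "continuous_on UNIV (\<sigma> (inv\<^bsub>G\<^esub> g))"
    using assms by (auto simp: topological_action_def homeomorphism_def)
  then have "continuous_on UNIV (\<lambda>x. apply_bcontfun f (\<sigma> (inv\<^bsub>G\<^esub> g) x))"
    by (rule continuous_on_compose2[OF continuous_on_apply_bcontfun[of UNIV]]) simp
  then have "(\<lambda>x. apply_bcontfun f (\<sigma> (inv\<^bsub>G\<^esub> g) x)) \<in> bcontfun"
    by (rule bcontfun_normI) (rule norm_bounded)
  then show ?thesis
    by (simp add: induced_action_def Bcontfun_inverse)
qed

lemma star_automorphism_induced_action:
  assumes act: "topological_action G \<sigma>" and g: "g \<in> carrier G"
  shows "star_automorphism (induced_action G \<sigma> g)"
proof -
  interpret group_action G UNIV \<sigma> using act by (simp add: topological_action_def)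
  interpret group G using group_hom by (rule group_hom.axioms(1))
  have cancel: "\<sigma> g (\<sigma> (inv\<^bsub>G\<^esub> g) x) = x" "\<sigma> (inv\<^bsub>G\<^esub> g) (\<sigma> g x) = x" for x
    using act g by (auto simp: topological_action_def homeomorphism_def)
  note ap = apply_induced_action[OF act]
  have "bij (induced_action G \<sigma> g)"
    by (rule bij_betw_byWitness[where f' = "induced_action G \<sigma> (inv\<^bsub>G\<^esub> g)"])
      (auto intro!: bcontfun_eqI simp: ap g cancel)
  then show ?thesis
    by (auto simp: star_automorphism_def ap g intro!: bcontfun_eqI)
qed

end

theory Submission
  imports Defs
begin

text \<open>
  A group element \<open>g\<close> with \<open>g (X - U) \<subseteq> V\<close> acts like a north-south map: \<open>g\<close> pushes everything outside
  \<open>U\<close> into \<open>V\<close>, and its inverse pushes everything outside \<open>V\<close> into \<open>U\<close>. If \<open>U\<close> and \<open>V\<close> are small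
  neighbourhoods of points \<open>u\<close> and \<open>v\<close>, then \<open>\<alpha>\<^sub>g a + \<alpha>\<^sub>g\<^sup>-\<^sup>1 a\<close> is close to the constant \<open>a u + a v\<close>
  except on \<open>U \<union> V\<close>. For many such elements \<open>t\<^sub>i\<close> with pairwise disjoint exceptional sets, each point is
  exceptional for at most one \<open>U\<^sub>i\<close> and one \<open>V\<^sub>i\<close>, so the average in the PHP property is uniformly close
  to the mean of \<open>a\<close> over the points \<open>u\<^sub>i, v\<^sub>i\<close> (\<open>north_south_average\<close>).

  For the sets in \<open>G\<close> take a base point \<open>z\<close> and \<open>C\<^sub>i = D\<^sub>i = {g. g z \<in> V\<^sub>i}\<close>. North-south dynamics puts
  \<open>t\<^sub>i\<^sup>-\<^sup>1 (G - D\<^sub>i)\<close> inside \<open>{g. g z \<in> U\<^sub>i}\<close>, so disjointness of all \<open>g V\<^sub>i\<close> and \<open>h U\<^sub>j\<close> in \<open>X\<close> gives both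
  disjointness in \<open>G\<close> and the bound 2 for the multiplicity (\<open>PHP_witness_return_sets\<close>).

  It remains to find points \<open>w\<^sub>1, \<dots>, w\<^sub>2\<^sub>n\<close> whose translates under a finite set of group elements are
  all distinct and whose mean approximates a given state on finitely many functions. They are
  chosen greedily (\<open>generic_points_with_small_discrepancy\<close>). A state never lies below the infimum of the
  real part of a function, so the next point can be chosen in a nonempty open set where the
  accumulated error vector and the new error have nearly nonpositive inner product; the squared
  length of the error then grows linearly in the number of points, and the mean error decays like
  the inverse square root. Topological freeness and the absence of isolated points make the
  excluded points a finite union of closed sets with empty interior, so the open set still contains
  an admissible point.

  Extreme proximality provides the \<open>t\<^sub>i\<close> and excludes isolated points; if it holds for a subgroup,
  the \<open>t\<^sub>i\<close> lie in that subgroup. The absolute statement is the case of the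
  whole group.
\<close>

section \<open>States on function algebras\<close>

lemma adj_one: "adj (1 :: 'a::unital_cstar_algebra) = 1"
  by (metis adj_adj adj_mult mult.right_neutral)

text \<open>Expanding \<open>(c + 1)\<^sup>* (c + 1)\<close> shows that \<open>\<phi> (c + c\<^sup>*)\<close> is real; applied to \<open>f\<close> and to \<open>\<i> f\<close> this
  determines \<open>\<phi> (f\<^sup>*)\<close>.\<close>

lemma state_adj:
  fixes \<phi> :: "'a::unital_cstar_algebra \<Rightarrow> complex"
  assumes "state \<phi>"
  shows "\<phi> (adj f) = cnj (\<phi> f)"
proof -
  have add: "\<And>a b. \<phi> (a + b) = \<phi> a + \<phi> b" and scale: "\<And>c a. \<phi> (c *\<^sub>C a) = c * \<phi> a"
    and pos: "\<And>a. \<phi> (adj a * a) \<in> \<real>\<^sub>\<ge>\<^sub>0" and one: "\<phi> 1 = 1"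
    using assms by (auto simp: state_def)
  have im: "Im (\<phi> (adj a * a)) = 0" for a
    using pos[of a] by (auto simp: complex_nonneg_Reals_iff)
  have sym: "Im (\<phi> c + \<phi> (adj c)) = 0" for c
  proof -
    have "adj (c + 1) * (c + 1) = adj c * c + (c + adj c) + 1"
      by (simp add: adj_add adj_one algebra_simps)
    then have "\<phi> (adj (c + 1) * (c + 1)) = \<phi> (adj c * c) + (\<phi> c + \<phi> (adj c)) + 1"
      by (simp only: add one)
    then show ?thesis
      using im[of "c + 1"] im[of c] by simp
  qed
  from sym[of "\<i> *\<^sub>C f"] have "Re (\<phi> f) = Re (\<phi> (adj f))"
    by (simp add: adj_scaleC scale)
  with sym[of f] show ?thesis
    by (simp add: complex_eq_iff)
qed

lemma state_sum_scaleC: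
  assumes "state \<phi>" "finite A"
  shows "\<phi> (\<Sum>a\<in>A. c a *\<^sub>C a) = (\<Sum>a\<in>A. c a * \<phi> a)"
proof -
  have "\<phi> 0 = 0"
    using assms(1) by (metis add_cancel_right_right state_def)
  show ?thesis
    using assms(2) by (induction rule: finite_induct) (use assms(1) \<open>\<phi> 0 = 0\<close> in \<open>auto simp: state_def\<close>)
qed

lemma apply_bcontfun_sum: "apply_bcontfun (\<Sum>i\<in>I. f i) x = (\<Sum>i\<in>I. apply_bcontfun (f i) x)"
  by (induction I rule: infinite_finite_induct) auto

text \<open>If \<open>Re f\<close> stayed above \<open>c = Re (\<phi> f) + e\<close>, then \<open>Re f - c\<close> would have the form \<open>s\<^sup>* s\<close>, and
  positivity of \<open>\<phi>\<close> would force \<open>Re (\<phi> f) \<ge> c\<close>. Positivity enters the approximation of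
  \<open>\<phi>\<close> by means of point values through this inequality.\<close>

lemma state_value_nearly_attained:
  fixes f :: "'x::topological_space \<Rightarrow>\<^sub>C complex"
  assumes "compact (UNIV :: 'x set)" "state \<phi>" "e > 0"
  shows "\<exists>x. Re (f x) < Re (\<phi> f) + e"
proof (rule ccontr)
  assume neg: "\<nexists>x. Re (f x) < Re (\<phi> f) + e"
  define c where "c = Re (\<phi> f) + e"
  define r where "r = (\<lambda>x. complex_of_real (sqrt (Re (f x) - c)))"
  have ge: "c \<le> Re (f x)" for x
    using neg by (auto simp: c_def not_less)
  have "r \<in> bcontfun"
    unfolding r_def by (intro continuous_in_bcontfun assms continuous_intros) auto
  then obtain s where s: "apply_bcontfun s = r"
    using Bcontfun_inverse by blast
  have "adj s * s + of_real c *\<^sub>C 1 = (1/2) *\<^sub>C (f + adj f)"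
  proof (rule bcontfun_eqI)
    fix x
    have "cnj (r x) * r x = of_real (Re (f x) - c)"
      using ge[of x] by (simp add: r_def flip: of_real_mult)
    then show "apply_bcontfun (adj s * s + of_real c *\<^sub>C 1) x = apply_bcontfun ((1/2) *\<^sub>C (f + adj f)) x"
      by (simp add: s complex_eq_iff)
  qed
  then have "\<phi> (adj s * s + of_real c *\<^sub>C 1) = \<phi> ((1/2) *\<^sub>C (f + adj f))"
    by simp
  then have "\<phi> (adj s * s) + of_real c = (1/2) * (\<phi> f + \<phi> (adj f))"
    using assms(2) by (simp add: state_def)
  then have "Re (\<phi> (adj s * s)) + c = Re (\<phi> f)"
    by (simp add: state_adj[OF assms(2)] complex_eq_iff)
  moreover have "Re (\<phi> (adj s * s)) \<ge> 0"
    using assms(2) by (auto simp: state_def complex_nonneg_Reals_iff)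
  ultimately show False
    using assms(3) by (simp add: c_def)
qed

section \<open>Generic points\<close>

lemma empty_interior_finite_Union:
  assumes "finite \<F>" "\<And>S. S \<in> \<F> \<Longrightarrow> closed S \<and> interior S = {}"
  shows "interior (\<Union>\<F>) = {}"
  using assms
proof (induction rule: finite_induct)
  case (insert S \<F>)
  then have "interior (S \<union> \<Union>\<F>) = interior S"
    by (intro interior_closed_Un_empty_interior) auto
  then show ?case
    using insert.prems by simp
qed simp

lemma topological_actionD:
  assumes "topological_action G \<sigma>" "group G"
  shows action_mult: "\<lbrakk>g \<in> carrier G; h \<in> carrier G\<rbrakk> \<Longrightarrow> \<sigma> (g \<otimes>\<^bsub>G\<^esub> h) x = \<sigma> g (\<sigma> h x)"
    and action_inv: "g \<in> carrier G \<Longrightarrow> \<sigma> g (\<sigma> (inv\<^bsub>G\<^esub> g) x) = x"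
      "g \<in> carrier G \<Longrightarrow> \<sigma> (inv\<^bsub>G\<^esub> g) (\<sigma> g x) = x"
    and action_continuous: "g \<in> carrier G \<Longrightarrow> continuous_on UNIV (\<sigma> g)"
  using assms group_action.composition_rule[of G UNIV \<sigma> x g h]
  by (auto simp: topological_action_def homeomorphism_def)

text \<open>For an isolated point \<open>x\<close>, taking \<open>U = V = {x}\<close> would give an injection of \<open>X - {x}\<close> into a single
  point.\<close>

lemma extremely_proximal_not_open_singleton:
  fixes \<sigma> :: "'g \<Rightarrow> 'x::t2_space \<Rightarrow> 'x"
  assumes "infinite (UNIV :: 'x set) \<or> card (UNIV :: 'x set) > 2"
    and "extremely_proximal H \<sigma>"
    and inj: "\<And>g. g \<in> carrier H \<Longrightarrow> inj (\<sigma> g)"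
  shows "\<not> open {x :: 'x}"
proof
  assume "open {x}"
  then obtain g where g: "g \<in> carrier H" "\<sigma> g ` (UNIV - {x}) \<subseteq> {x}"
    using assms(2) unfolding extremely_proximal_def by (metis insert_not_empty)
  have inj': "inj_on (\<sigma> g) (UNIV - {x})"
    using inj[OF g(1)] by (rule inj_on_subset) simp
  have "finite (UNIV - {x})" "card (UNIV - {x}) \<le> 1"
    using inj_on_finite[OF inj' g(2)] card_inj_on_le[OF inj' g(2)] by auto
  then show False
    using assms(1) by (auto simp: card_Diff_singleton)
qed

lemma generic_point_exists:
  fixes \<sigma> :: "'g \<Rightarrow> 'x::t2_space \<Rightarrow> 'x"
  assumes "group G" "topological_action G \<sigma>" "topologically_free G \<sigma>"
    and "\<And>x :: 'x. \<not> open {x}"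
    and "open W" "W \<noteq> {}" "finite P" "finite H" "H \<subseteq> carrier G"
  shows "\<exists>x\<in>W. x \<notin> P \<and> (\<forall>h\<in>H. h \<noteq> \<one>\<^bsub>G\<^esub> \<longrightarrow> \<sigma> h x \<noteq> x)"
proof -
  define \<F> where "\<F> = (\<lambda>x. {x}) ` P \<union> (\<lambda>h. {x. \<sigma> h x = x}) ` (H - {\<one>\<^bsub>G\<^esub>})"
  have "interior (\<Union>\<F>) = {}"
  proof (rule empty_interior_finite_Union)
    show "finite \<F>"
      using assms by (simp add: \<F>_def)
    fix S assume "S \<in> \<F>"
    then consider x where "S = {x}" | h where "h \<in> carrier G" "h \<noteq> \<one>\<^bsub>G\<^esub>" "S = {x. \<sigma> h x = x}"
      using assms(9) by (auto simp: \<F>_def)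
    then show "closed S \<and> interior S = {}"
    proof cases
      case 1
      have "interior {x} = {}"
        using assms(4)[of x] interior_subset[of "{x}"] open_interior[of "{x}"]
        by (metis subset_singletonD)
      then show ?thesis using 1 by simp
    next
      case 2
      then show ?thesis
        using assms(3) action_continuous[OF assms(2,1)]
        by (auto simp: topologically_free_def intro!: closed_Collect_eq continuous_on_id)
    qed
  qed
  then have "\<not> W \<subseteq> \<Union>\<F>"
    using assms(5,6) interior_maximal by blast
  then show ?thesis
    by (auto simp: \<F>_def)
qed

text \<open>The conditions on the new point are those that \<open>generic_point_exists\<close> provides for the finite set
  \<open>F\<^sup>-\<^sup>1 F\<close>: a coincidence \<open>\<sigma> g x = \<sigma> h y\<close> with \<open>g, h \<in> F\<close> amounts to \<open>x = \<sigma> (g\<^sup>-\<^sup>1 h) y\<close>.\<close>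

lemma inj_on_add_generic_point:
  assumes "group G" "topological_action G \<sigma>" "F \<subseteq> carrier G"
    and inj: "inj_on (\<lambda>(g, i). \<sigma> g (w i)) (F \<times> I)" and "k \<notin> I"
    and new: "\<And>g h i. \<lbrakk>g \<in> F; h \<in> F; i \<in> I\<rbrakk> \<Longrightarrow> x \<noteq> \<sigma> (inv\<^bsub>G\<^esub> g \<otimes>\<^bsub>G\<^esub> h) (w i)"
    and free: "\<And>g h. \<lbrakk>g \<in> F; h \<in> F; inv\<^bsub>G\<^esub> g \<otimes>\<^bsub>G\<^esub> h \<noteq> \<one>\<^bsub>G\<^esub>\<rbrakk> \<Longrightarrow> \<sigma> (inv\<^bsub>G\<^esub> g \<otimes>\<^bsub>G\<^esub> h) x \<noteq> x"
  shows "inj_on (\<lambda>(g, i). \<sigma> g ((w(k := x)) i)) (F \<times> insert k I)"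
proof -
  interpret group G by fact
  note act = topological_actionD[OF assms(2,1)]
  have F: "g \<in> carrier G" if "g \<in> F" for g
    using that assms(3) by auto
  have move: "y = \<sigma> (inv\<^bsub>G\<^esub> g \<otimes>\<^bsub>G\<^esub> h) z" if "\<sigma> g y = \<sigma> h z" "g \<in> F" "h \<in> F" for g h y z
    using act(3)[OF F[OF that(2)], of y] that F by (simp add: act(1))
  have old_new: False if "\<sigma> g x = \<sigma> h (w i)" "g \<in> F" "h \<in> F" "i \<in> I" for g h i
    using move[OF that(1-3)] new[OF that(2-4)] by simp
  have new_new: "g = h" if "\<sigma> g x = \<sigma> h x" "g \<in> F" "h \<in> F" for g h
  proof -
    have "inv\<^bsub>G\<^esub> g \<otimes>\<^bsub>G\<^esub> h = \<one>\<^bsub>G\<^esub>"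
      using move[OF that] free[OF that(2,3)] by metis
    then show ?thesis
      using F that(2,3) by (metis inv_closed inv_equality inv_inv)
  qed
  have old_old: "g = h \<and> i = j" if "\<sigma> g (w i) = \<sigma> h (w j)" "g \<in> F" "h \<in> F" "i \<in> I" "j \<in> I" for g h i j
    using inj_onD[OF inj, of "(g, i)" "(h, j)"] that by auto
  show ?thesis
  proof (rule inj_onI, clarify)
    fix g i h j
    assume g: "g \<in> F" and h: "h \<in> F" and i: "i \<in> insert k I" and j: "j \<in> insert k I"
      and eq: "\<sigma> g ((w(k := x)) i) = \<sigma> h ((w(k := x)) j)"
    show "g = h \<and> i = j"
    proof (cases "i = k"; cases "j = k")
      assume "i = k" "j = k"
      then show ?thesis using new_new[of g h] eq g h by simp
    next
      assume "i = k" "j \<noteq> k"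
      then show ?thesis using old_new[of g h j] eq g h j by simp
    next
      assume "i \<noteq> k" "j = k"
      then show ?thesis using old_new[of h g i] eq g h i by simp
    next
      assume "i \<noteq> k" "j \<noteq> k"
      then show ?thesis using old_old[of g i h j] eq g h i j by simp
    qed
  qed
qed

text \<open>Let \<open>s a\<close> be the accumulated error at \<open>a\<close>. Adding a point \<open>x\<close> changes the sum of the squared errors
  by twice the real part of \<open>\<Sum>a. cnj (s a) * (a x - \<phi> a)\<close> plus a bounded term. The function
  \<open>f = \<Sum>a. cnj (s a) a\<close> takes values with real part below \<open>Re (\<phi> f) + 1\<close>, and it does so on an open set;
  there the cross term is less than 2. So every step costs at most a constant, and the chosen point
  can still be generic.\<close>

lemma generic_points_with_small_discrepancy:
  fixes \<sigma> :: "'g \<Rightarrow> 'x::t2_space \<Rightarrow> 'x" and \<phi> :: "('x \<Rightarrow>\<^sub>C complex) \<Rightarrow> complex"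
  assumes "group G" "compact (UNIV :: 'x set)" "topological_action G \<sigma>" "topologically_free G \<sigma>"
    and "\<And>x :: 'x. \<not> open {x}"
    and "finite F" "F \<subseteq> carrier G" "state \<phi>" "finite A"
  shows "\<exists>w :: nat \<Rightarrow> 'x. inj_on (\<lambda>(g, i). \<sigma> g (w i)) (F \<times> {1..m}) \<and>
    (\<Sum>a\<in>A. (cmod (\<Sum>i=1..m. apply_bcontfun a (w i) - \<phi> a))\<^sup>2)
      \<le> (2 + (\<Sum>a\<in>A. (norm a + cmod (\<phi> a))\<^sup>2)) * real m"
proof (induction m)
  case 0
  show ?case by simp
next
  case (Suc m)
  then obtain w where inj: "inj_on (\<lambda>(g, i). \<sigma> g (w i)) (F \<times> {1..m})"
    and disc: "(\<Sum>a\<in>A. (cmod (\<Sum>i=1..m. apply_bcontfun a (w i) - \<phi> a))\<^sup>2)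
      \<le> (2 + (\<Sum>a\<in>A. (norm a + cmod (\<phi> a))\<^sup>2)) * real m"
    by blast
  interpret group G by fact
  define s where "s = (\<lambda>a. \<Sum>i=1..m. apply_bcontfun a (w i) - \<phi> a)"
  define f where "f = (\<Sum>a\<in>A. cnj (s a) *\<^sub>C a)"
  \<comment> \<open>Points of \<open>P\<close>, and fixed points of nontrivial elements of \<open>H\<close>, would create coincidences
    among the translates.\<close>
  define H where "H = (\<lambda>(g, h). inv\<^bsub>G\<^esub> g \<otimes>\<^bsub>G\<^esub> h) ` (F \<times> F)"
  define P where "P = (\<lambda>(h, i). \<sigma> h (w i)) ` (H \<times> {1..m})"
  have W: "open {x. Re (f x) < Re (\<phi> f) + 1}"
    by (intro open_Collect_less continuous_intros) (auto intro: continuous_on_apply_bcontfun)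
  have "{x. Re (f x) < Re (\<phi> f) + 1} \<noteq> {}"
    using state_value_nearly_attained[OF assms(2,8), of 1 f] by auto
  moreover have "finite H" "H \<subseteq> carrier G"
    using assms(6,7) by (auto simp: H_def)
  moreover have "finite P"
    using \<open>finite H\<close> by (simp add: P_def)
  ultimately obtain x where x: "Re (f x) < Re (\<phi> f) + 1" "x \<notin> P"
      "\<forall>h\<in>H. h \<noteq> \<one>\<^bsub>G\<^esub> \<longrightarrow> \<sigma> h x \<noteq> x"
    using generic_point_exists[OF assms(1,3-5) W] by blast
  have inj': "inj_on (\<lambda>(g, i). \<sigma> g ((w(Suc m := x)) i)) (F \<times> {1..Suc m})"
  proof -
    have "inj_on (\<lambda>(g, i). \<sigma> g ((w(Suc m := x)) i)) (F \<times> insert (Suc m) {1..m})"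
    proof (rule inj_on_add_generic_point[OF assms(1,3,7) inj])
      fix g h assume gh: "g \<in> F" "h \<in> F"
      then have H: "inv\<^bsub>G\<^esub> g \<otimes>\<^bsub>G\<^esub> h \<in> H" by (auto simp: H_def)
      then show "x \<noteq> \<sigma> (inv\<^bsub>G\<^esub> g \<otimes>\<^bsub>G\<^esub> h) (w i)" if "i \<in> {1..m}" for i
        using x(2) that by (auto simp: P_def)
      show "\<sigma> (inv\<^bsub>G\<^esub> g \<otimes>\<^bsub>G\<^esub> h) x \<noteq> x" if "inv\<^bsub>G\<^esub> g \<otimes>\<^bsub>G\<^esub> h \<noteq> \<one>\<^bsub>G\<^esub>"
        using x(3) H that by blast
    qed simp
    then show ?thesis by (simp add: atLeastAtMostSuc_conv)
  qed
  have cross: "Re (\<Sum>a\<in>A. cnj (s a) * (apply_bcontfun a x - \<phi> a)) < 1"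
    using x(1) by (simp add: f_def state_sum_scaleC[OF assms(8,9)] apply_bcontfun_sum
        right_diff_distrib sum_subtractf)
  have sq: "(cmod (u + v))\<^sup>2 = (cmod u)\<^sup>2 + 2 * Re (cnj u * v) + (cmod v)\<^sup>2" for u v
    unfolding cmod_power2 by (simp add: power2_eq_square algebra_simps)
  have step: "(\<Sum>i=1..Suc m. apply_bcontfun a ((w(Suc m := x)) i) - \<phi> a) = s a + (apply_bcontfun a x - \<phi> a)"
    for a :: "'x \<Rightarrow>\<^sub>C complex"
  proof -
    have "(\<Sum>i=1..m. a ((w(Suc m := x)) i) - \<phi> a) = s a"
      unfolding s_def by (intro sum.cong) auto
    then show ?thesis by simp
  qed
  have "(\<Sum>a\<in>A. (cmod (\<Sum>i=1..Suc m. apply_bcontfun a ((w(Suc m := x)) i) - \<phi> a))\<^sup>2)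
      = (\<Sum>a\<in>A. (cmod (s a))\<^sup>2) + 2 * Re (\<Sum>a\<in>A. cnj (s a) * (apply_bcontfun a x - \<phi> a))
        + (\<Sum>a\<in>A. (cmod (apply_bcontfun a x - \<phi> a))\<^sup>2)"
    unfolding step sq by (simp only: sum.distrib Re_sum sum_distrib_left)
  also have "\<dots> \<le> (\<Sum>a\<in>A. (cmod (s a))\<^sup>2) + 2 + (\<Sum>a\<in>A. (norm a + cmod (\<phi> a))\<^sup>2)"
  proof -
    have "(cmod (apply_bcontfun a x - \<phi> a))\<^sup>2 \<le> (norm a + cmod (\<phi> a))\<^sup>2" for a :: "'x \<Rightarrow>\<^sub>C complex"
      using norm_triangle_ineq4[of "a x" "\<phi> a"] norm_bounded[of a x] by (intro power_mono) auto
    then have "(\<Sum>a\<in>A. (cmod (apply_bcontfun a x - \<phi> a))\<^sup>2) \<le> (\<Sum>a\<in>A. (norm a + cmod (\<phi> a))\<^sup>2)"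
      by (intro sum_mono)
    then show ?thesis using cross by simp
  qed
  also have "\<dots> \<le> (2 + (\<Sum>a\<in>A. (norm a + cmod (\<phi> a))\<^sup>2)) * real (Suc m)"
    using disc by (simp add: s_def algebra_simps)
  finally show ?case using inj' by blast
qed

section \<open>Disjoint translates\<close>

lemma finite_disjoint_open_neighbourhoods:
  fixes p :: "'i \<Rightarrow> 'x::t2_space"
  assumes "finite I" "inj_on p I"
  shows "\<exists>U. (\<forall>i\<in>I. open (U i) \<and> p i \<in> U i) \<and> disjoint_family_on U I"
  using assms
proof (induction rule: finite_induct)
  case empty
  show ?case by (simp add: disjoint_family_on_def)
next
  case (insert k I)
  then obtain U where U: "\<And>i. i \<in> I \<Longrightarrow> open (U i) \<and> p i \<in> U i" "disjoint_family_on U I"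
    by auto
  have "\<exists>V V'. open V \<and> open V' \<and> p i \<in> V \<and> p k \<in> V' \<and> V \<inter> V' = {}" if "i \<in> I" for i
    using inj_onD[OF insert.prems, of i k] insert.hyps(2) that by (intro hausdorff) auto
  then obtain V V' where V: "\<And>i. i \<in> I \<Longrightarrow> open (V i) \<and> open (V' i) \<and> p i \<in> V i \<and> p k \<in> V' i \<and> V i \<inter> V' i = {}"
    by metis
  define U' where "U' = (\<lambda>i. if i = k then \<Inter>i\<in>I. V' i else U i \<inter> V i)"
  have "open (U' i) \<and> p i \<in> U' i" if "i \<in> insert k I" for i
    using that U(1) V insert.hyps by (auto simp: U'_def intro!: open_INT open_Int)
  moreover have "disjoint_family_on U' (insert k I)"
    using U(2) V insert.hyps unfolding disjoint_family_on_def U'_def by (auto; blast)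
  ultimately show ?case by blast
qed

text \<open>Disjoint neighbourhoods of the finitely many translates \<open>\<sigma> g (w i)\<close> are pulled back along the
  continuous maps \<open>\<sigma> g\<close>. The sets \<open>N i\<close> record further smallness requirements.\<close>

lemma disjoint_translates:
  fixes \<sigma> :: "'g \<Rightarrow> 'x::t2_space \<Rightarrow> 'x"
  assumes "group G" "topological_action G \<sigma>" "finite F" "F \<subseteq> carrier G" "finite I"
    and inj: "inj_on (\<lambda>(g, i). \<sigma> g (w i)) (F \<times> I)"
    and N: "\<And>i. i \<in> I \<Longrightarrow> open (N i) \<and> w i \<in> N i"
  shows "\<exists>W. (\<forall>i\<in>I. open (W i) \<and> w i \<in> W i \<and> W i \<subseteq> N i) \<and>
    disjoint_family_on (\<lambda>(g, i). \<sigma> g ` W i) (F \<times> I)"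
proof -
  obtain U where U: "\<forall>j\<in>F \<times> I. open (U j) \<and> (\<lambda>(g, i). \<sigma> g (w i)) j \<in> U j"
      "disjoint_family_on U (F \<times> I)"
    using finite_disjoint_open_neighbourhoods[OF _ inj] assms(3,5) by auto
  define W where "W = (\<lambda>i. N i \<inter> (\<Inter>g\<in>F. \<sigma> g -` U (g, i)))"
  have "open (W i) \<and> w i \<in> W i \<and> W i \<subseteq> N i" if "i \<in> I" for i
  proof -
    have "open (\<sigma> g -` U (g, i))" if "g \<in> F" for g
      using U(1) that \<open>i \<in> I\<close> assms(4) action_continuous[OF assms(2,1), of g]
      by (intro open_vimage) auto
    then show ?thesis
      using N[OF that] U(1) that assms(3) by (auto simp: W_def intro!: open_Int open_INT)
  qed
  moreover have "disjoint_family_on (\<lambda>(g, i). \<sigma> g ` W i) (F \<times> I)"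
  proof -
    have "(\<lambda>(g, i). \<sigma> g ` W i) j \<subseteq> U j" if "j \<in> F \<times> I" for j
      using that by (auto simp: W_def)
    then show ?thesis
      using U(2) unfolding disjoint_family_on_def by blast
  qed
  ultimately show ?thesis by blast
qed


lemma card_disjoint_family_containing_le:
  assumes "disjoint_family_on V I"
  shows "card {i\<in>I. x \<in> V i} \<le> 1"
proof -
  have "i = j" if "i \<in> {i\<in>I. x \<in> V i}" "j \<in> {i\<in>I. x \<in> V i}" for i j
    using disjoint_family_onD[OF assms, of i j] that by blast
  then show ?thesis
    using card_le_Suc0_iff_eq[of "{i\<in>I. x \<in> V i}"] by (cases "finite {i\<in>I. x \<in> V i}") auto
qed

text \<open>A fixed point \<open>x\<close> lies in at most one \<open>V i\<close>, so the weaker bound \<open>B\<close> is paid only once.\<close>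

lemma sum_le_disjoint_exceptions:
  fixes b :: "'i \<Rightarrow> real"
  assumes "disjoint_family_on V I" "finite I" "B \<ge> 0" "\<delta> \<ge> 0"
    and "\<And>i. i \<in> I \<Longrightarrow> x \<notin> V i \<Longrightarrow> b i \<le> \<delta>" "\<And>i. i \<in> I \<Longrightarrow> b i \<le> B"
  shows "(\<Sum>i\<in>I. b i) \<le> real (card I) * \<delta> + B"
proof -
  have "(\<Sum>i\<in>I. b i) \<le> (\<Sum>i\<in>I. \<delta> + (if x \<in> V i then B else 0))"
    using assms by (intro sum_mono) (fastforce intro: order_trans)
  also have "\<dots> = real (card I) * \<delta> + real (card {i\<in>I. x \<in> V i}) * B"
    using assms(2) by (simp add: sum.distrib sum.inter_filter[symmetric])
  also have "\<dots> \<le> real (card I) * \<delta> + B"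
    using mult_right_mono[of "real (card {i\<in>I. x \<in> V i})" 1 B]
      card_disjoint_family_containing_le[OF assms(1), of x] assms(3) by simp
  finally show ?thesis .
qed

section \<open>North-south elements\<close>

lemma north_south_inverse:
  assumes "group G" "topological_action G \<sigma>" "g \<in> carrier G" "\<sigma> g ` (UNIV - U) \<subseteq> V"
    and "x \<notin> V"
  shows "\<sigma> (inv\<^bsub>G\<^esub> g) x \<in> U"
  using assms(4,5) action_inv(1)[OF assms(2,1,3), of x] by (metis DiffI UNIV_I image_subset_iff)

lemma inv_induced_action:
  assumes "group G" "topological_action G \<sigma>" "g \<in> carrier G"
  shows "inv_into UNIV (induced_action G \<sigma> g) a = induced_action G \<sigma> (inv\<^bsub>G\<^esub> g) a"
proof -
  interpret group G by fact
  have "induced_action G \<sigma> g (induced_action G \<sigma> (inv\<^bsub>G\<^esub> g) a) = a"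
    using assms by (intro bcontfun_eqI) (simp add: apply_induced_action action_inv)
  moreover have "inj (induced_action G \<sigma> g)"
    using star_automorphism_induced_action[OF assms(2,3)] by (simp add: star_automorphism_def bij_def)
  ultimately show ?thesis
    by (metis inv_f_f)
qed

text \<open>At a point \<open>x\<close>, the value \<open>a (\<sigma> (inv t i) x)\<close> is within \<open>\<delta>\<close> of \<open>a (u i)\<close> unless \<open>x \<in> V i\<close>, and
  \<open>a (\<sigma> (t i) x)\<close> is within \<open>\<delta>\<close> of \<open>a (v i)\<close> unless \<open>x \<in> U i\<close>. The three terms of the bound are this
  oscillation, the exceptional indices, and the distance from the mean over the points to \<open>c\<close>.\<close>

lemma north_south_average:
  fixes \<sigma> :: "'g \<Rightarrow> 'x::topological_space \<Rightarrow> 'x" and a :: "'x \<Rightarrow>\<^sub>C complex"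
  assumes "group G" "topological_action G \<sigma>" "n > 0" "\<delta> \<ge> 0"
    and t: "\<And>i. i \<in> {1..n} \<Longrightarrow> t i \<in> carrier G \<and> \<sigma> (t i) ` (UNIV - U i) \<subseteq> V i"
    and disj: "disjoint_family_on U {1..n}" "disjoint_family_on V {1..n}"
    and U: "\<And>i x. i \<in> {1..n} \<Longrightarrow> x \<in> U i \<Longrightarrow> cmod (a x - a (u i)) \<le> \<delta>"
    and V: "\<And>i x. i \<in> {1..n} \<Longrightarrow> x \<in> V i \<Longrightarrow> cmod (a x - a (v i)) \<le> \<delta>"
  shows "norm ((1 / (2 * real n)) *\<^sub>R (\<Sum>i=1..n. induced_action G \<sigma> (t i) a
      + inv_into UNIV (induced_action G \<sigma> (t i)) a) - c *\<^sub>C 1)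
    \<le> \<delta> + 2 * norm a / real n
      + cmod (\<Sum>i=1..n. (a (u i) - c) + (a (v i) - c)) / (2 * real n)"
proof (rule norm_bound)
  fix x
  interpret group G by fact
  let ?f = "(1 / (2 * real n)) *\<^sub>R (\<Sum>i=1..n. induced_action G \<sigma> (t i) a
      + inv_into UNIV (induced_action G \<sigma> (t i)) a) - c *\<^sub>C 1"
  define p where "p = (\<lambda>i. a (\<sigma> (inv\<^bsub>G\<^esub> t i) x) - a (u i))"
  define q where "q = (\<lambda>i. a (\<sigma> (t i) x) - a (v i))"
  define S where "S = (\<Sum>i=1..n. (a (u i) - c) + (a (v i) - c))"
  have diff_le: "cmod (a y - a z) \<le> 2 * norm a" for y z
    using norm_triangle_ineq4[of "a y" "a z"] norm_bounded[of a y] norm_bounded[of a z] by simp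
  have p: "cmod (\<Sum>i=1..n. p i) \<le> real n * \<delta> + 2 * norm a"
  proof -
    have "(\<Sum>i=1..n. cmod (p i)) \<le> real (card {1..n}) * \<delta> + 2 * norm a"
    proof (rule sum_le_disjoint_exceptions[OF disj(2), where x = x])
      fix i assume i: "i \<in> {1..n}" "x \<notin> V i"
      then show "cmod (p i) \<le> \<delta>"
        using U[OF i(1)] t[OF i(1)] north_south_inverse[OF assms(1,2), of "t i" "U i" "V i" x]
        by (simp add: p_def)
    qed (auto simp: p_def diff_le assms(4))
    then show ?thesis
      using norm_sum[of p "{1..n}"] by simp
  qed
  have q: "cmod (\<Sum>i=1..n. q i) \<le> real n * \<delta> + 2 * norm a"
  proof -
    have "(\<Sum>i=1..n. cmod (q i)) \<le> real (card {1..n}) * \<delta> + 2 * norm a"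
      using V t assms(4)
      by (intro sum_le_disjoint_exceptions[OF disj(1), where x = x])
        (auto simp: q_def diff_le image_subset_iff)
    then show ?thesis
      using norm_sum[of q "{1..n}"] by simp
  qed
  have "(\<Sum>i=1..n. induced_action G \<sigma> (t i) a x + inv_into UNIV (induced_action G \<sigma> (t i)) a x)
      = (\<Sum>i=1..n. p i + q i + ((a (u i) - c) + (a (v i) - c)) + 2 * c)"
    using t by (intro sum.cong)
      (auto simp: inv_induced_action[OF assms(1,2)] apply_induced_action[OF assms(2)] p_def q_def)
  also have "\<dots> = (\<Sum>i=1..n. p i) + (\<Sum>i=1..n. q i) + S + 2 * of_nat n * c"
    by (simp only: sum.distrib S_def) simp
  finally have eq: "?f x = ((\<Sum>i=1..n. p i) + (\<Sum>i=1..n. q i) + S) /\<^sub>R (2 * real n)"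
    using assms(3) by (simp add: apply_bcontfun_sum scaleR_conv_of_real[where 'a = complex] field_simps)
  have "cmod (?f x) = cmod ((\<Sum>i=1..n. p i) + (\<Sum>i=1..n. q i) + S) / (2 * real n)"
    unfolding eq norm_scaleR using assms(3) by (simp add: field_simps)
  also have "\<dots> \<le> ((real n * \<delta> + 2 * norm a) + (real n * \<delta> + 2 * norm a) + cmod S) / (2 * real n)"
    using norm_triangle_ineq[of "(\<Sum>i=1..n. p i) + (\<Sum>i=1..n. q i)" S]
      norm_triangle_ineq[of "\<Sum>i=1..n. p i" "\<Sum>i=1..n. q i"] p q
    by (intro divide_right_mono) linarith+
  also have "\<dots> = \<delta> + 2 * norm a / real n + cmod S / (2 * real n)"
    using assms(3) by (simp add: field_simps)
  finally show "norm (?f x) \<le> \<delta> + 2 * norm a / real n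
      + cmod (\<Sum>i=1..n. (a (u i) - c) + (a (v i) - c)) / (2 * real n)"
    by (simp add: S_def)
qed

text \<open>The orbit map \<open>k \<mapsto> \<sigma> k z\<close> of an arbitrary base point transports the dynamics on \<open>X\<close> to \<open>G\<close>:
  each of the sets in the disjointness condition is contained in the preimage of one of the
  disjoint translates. An element lies in at most one of the sets \<open>D i\<close> and in at most one of the
  sets \<open>t j\<^sup>-\<^sup>1 (G - C j)\<close>, hence the constant 2.\<close>

lemma PHP_witness_return_sets:
  fixes \<sigma> :: "'g \<Rightarrow> 'x::topological_space \<Rightarrow> 'x" and z :: 'x
  assumes "group G" "topological_action G \<sigma>" "F \<subseteq> carrier G"
    and t: "\<And>i. i \<in> {1..n} \<Longrightarrow> t i \<in> carrier G \<and> \<sigma> (t i) ` (UNIV - U i) \<subseteq> V i"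
    and disj: "disjoint_family_on U {1..n}" "disjoint_family_on V {1..n}"
      "disjoint_family_on (case_sum (\<lambda>(g, i). \<sigma> g ` V i) (\<lambda>(h, j). \<sigma> h ` U j))
        ((F \<times> {1..n}) <+> (F \<times> {1..n}))"
    and "2 \<le> \<epsilon> * sqrt (real n)"
    and avg: "\<And>a. a \<in> A \<Longrightarrow> norm ((1 / (2 * real n)) *\<^sub>R
         (\<Sum>i=1..n. \<alpha> (t i) a + inv_into UNIV (\<alpha> (t i)) a) - \<phi> a *\<^sub>C 1) < \<epsilon>"
  defines "C \<equiv> \<lambda>i. {g \<in> carrier G. \<sigma> g z \<in> V i}"
  shows "PHP_witness G \<alpha> \<phi> A F \<epsilon> n t C C"
proof -
  interpret group G by fact
  note act = topological_actionD[OF assms(2,1)]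
  have F: "g \<in> carrier G" if "g \<in> F" for g
    using that assms(3) by auto
  have returns: "\<sigma> (inv\<^bsub>G\<^esub> t i \<otimes>\<^bsub>G\<^esub> k) z \<in> U i" if "i \<in> {1..n}" "k \<in> carrier G" "k \<notin> C i" for i k
    using that t[OF that(1)] north_south_inverse[OF assms(1,2), of "t i" "U i" "V i" "\<sigma> k z"]
    by (auto simp: C_def act(1))
  define E where "E = case_sum (\<lambda>(g, i). \<sigma> g ` V i) (\<lambda>(h, j). \<sigma> h ` U j)"
  define L where "L = case_sum (\<lambda>(g, i). g <#\<^bsub>G\<^esub> C i)
      (\<lambda>(h, j). (h \<otimes>\<^bsub>G\<^esub> inv\<^bsub>G\<^esub> (t j)) <#\<^bsub>G\<^esub> (carrier G - C j))"
  have L: "\<sigma> k z \<in> E s" if s: "s \<in> (F \<times> {1..n}) <+> (F \<times> {1..n})" and k: "k \<in> L s" for k s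
  proof (cases s)
    case (Inl p)
    then obtain g i where p: "s = Inl (g, i)" "g \<in> F" "i \<in> {1..n}"
      using s by auto
    then obtain c where "c \<in> C i" "k = g \<otimes>\<^bsub>G\<^esub> c"
      using k by (auto simp: L_def l_coset_def)
    then show ?thesis
      using p F by (auto simp: E_def C_def act(1))
  next
    case (Inr p)
    then obtain h j where p: "s = Inr (h, j)" "h \<in> F" "j \<in> {1..n}"
      using s by auto
    then obtain c where c: "c \<in> carrier G" "c \<notin> C j" "k = h \<otimes>\<^bsub>G\<^esub> inv\<^bsub>G\<^esub> (t j) \<otimes>\<^bsub>G\<^esub> c"
      using k by (auto simp: L_def l_coset_def)
    then have "\<sigma> k z = \<sigma> h (\<sigma> (inv\<^bsub>G\<^esub> (t j) \<otimes>\<^bsub>G\<^esub> c) z)"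
      using p F t[OF p(3)] by (simp add: m_assoc act(1))
    then show ?thesis
      using p returns[OF p(3) c(1,2)] by (auto simp: E_def)
  qed
  have "disjoint_family_on L ((F \<times> {1..n}) <+> (F \<times> {1..n}))"
    unfolding disjoint_family_on_def
  proof (intro ballI impI equals0I)
    fix r s k
    assume rs: "r \<in> (F \<times> {1..n}) <+> (F \<times> {1..n})" "s \<in> (F \<times> {1..n}) <+> (F \<times> {1..n})" "r \<noteq> s"
      and "k \<in> L r \<inter> L s"
    then have "\<sigma> k z \<in> E r \<inter> E s"
      using L by blast
    then show False
      using disjoint_family_onD[OF disj(3)[folded E_def] rs] by blast
  qed
  moreover have "(SUP g\<in>carrier G. real (card ({i\<in>{1..n}. g \<in> C i} \<union>
         {j\<in>{1..n}. g \<in> inv\<^bsub>G\<^esub> (t j) <#\<^bsub>G\<^esub> (carrier G - C j)}))) \<le> \<epsilon> * sqrt (real n)"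
  proof (rule cSUP_least)
    fix g assume "g \<in> carrier G"
    let ?X = "{i\<in>{1..n}. g \<in> C i} \<union> {j\<in>{1..n}. g \<in> inv\<^bsub>G\<^esub> (t j) <#\<^bsub>G\<^esub> (carrier G - C j)}"
    have "?X \<subseteq> {i\<in>{1..n}. \<sigma> g z \<in> V i} \<union> {j\<in>{1..n}. \<sigma> g z \<in> U j}"
      using returns by (auto simp: C_def l_coset_def)
    then have "card ?X \<le> card ({i\<in>{1..n}. \<sigma> g z \<in> V i} \<union> {j\<in>{1..n}. \<sigma> g z \<in> U j})"
      by (intro card_mono) auto
    also have "\<dots> \<le> 1 + 1"
      using card_Un_le add_mono[OF card_disjoint_family_containing_le[OF disj(2)]
          card_disjoint_family_containing_le[OF disj(1)]] by (rule order_trans)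
    finally show "real (card ?X) \<le> \<epsilon> * sqrt (real n)"
      using assms(8) by linarith
  qed auto
  ultimately show ?thesis
    using t avg by (auto simp: PHP_witness_def L_def C_def)
qed

section \<open>The PHP property\<close>

text \<open>The \<open>2n\<close> generic points are split into \<open>v\<^sub>i = w i\<close> and \<open>u\<^sub>i = w (n + i)\<close>. The error \<open>\<epsilon>\<close> is spent
  in quarters: one on the oscillation of the functions on the neighbourhoods, one on the exceptional
  indices, one on the discrepancy of the points, and one to make the inequality strict.\<close>

lemma exists_PHP_witness_in_subgroup:
  fixes G :: "('g, 'm) monoid_scheme" and \<sigma> :: "'g \<Rightarrow> 'x::t2_space \<Rightarrow> 'x"
    and A :: "('x \<Rightarrow>\<^sub>C complex) set"
  assumes "group G" "compact (UNIV :: 'x set)"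
    and "infinite (UNIV :: 'x set) \<or> card (UNIV :: 'x set) > 2"
    and "topological_action G \<sigma>" "topologically_free G \<sigma>"
    and "subgroup K G" "extremely_proximal (G\<lparr>carrier := K\<rparr>) \<sigma>"
    and "state \<phi>" "finite A" "finite F" "F \<subseteq> carrier G" "\<epsilon> > 0"
  shows "\<exists>n\<ge>N. \<exists>t C D. PHP_witness G (induced_action G \<sigma>) \<phi> A F \<epsilon> n t C D
    \<and> (\<forall>i\<in>{1..n}. t i \<in> K)"
proof -
  interpret group G by fact
  note act = topological_actionD[OF assms(4,1)]
  have K: "g \<in> carrier G" if "g \<in> K" for g
    using that subgroup.subset[OF assms(6)] by auto
  have ep: "\<exists>g\<in>K. \<sigma> g ` (UNIV - U) \<subseteq> V" if "open U" "open V" "U \<noteq> {}" "V \<noteq> {}" for U V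
    using assms(7) that by (simp add: extremely_proximal_def)
  have no_isolated: "\<not> open {x}" for x :: 'x
    using act(3) K
    by (intro extremely_proximal_not_open_singleton[OF assms(3,7)]) (auto intro: inj_on_inverseI)
  \<comment> \<open>Including the unit makes the neighbourhoods themselves disjoint, also when \<open>F\<close> is empty.\<close>
  define F' where "F' = insert \<one>\<^bsub>G\<^esub> F"
  have F': "finite F'" "F' \<subseteq> carrier G" "\<one>\<^bsub>G\<^esub> \<in> F'" "F \<subseteq> F'"
    using assms(10,11) by (auto simp: F'_def)
  define B where "B = (\<Sum>a\<in>A. norm a)"
  define M where "M = 2 + (\<Sum>a\<in>A. (norm a + cmod (\<phi> a))\<^sup>2)"
  have B: "norm a \<le> B" if "a \<in> A" for a
    using that assms(9) unfolding B_def by (intro member_le_sum) auto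
  have "B \<ge> 0" "M \<ge> 0"
    by (auto simp: B_def M_def intro!: sum_nonneg add_nonneg_nonneg)
  \<comment> \<open>The summands make \<open>n \<ge> N\<close>, \<open>n > 0\<close>, \<open>2 B / n \<le> \<epsilon> / 4\<close>, \<open>sqrt (2 n M) / (2 n) \<le> \<epsilon> / 4\<close> and
    \<open>2 \<le> \<epsilon> * sqrt n\<close> hold.\<close>
  obtain n where n: "real n \<ge> real N + 1 + 8 * B / \<epsilon> + 8 * M / \<epsilon>\<^sup>2 + 4 / \<epsilon>\<^sup>2"
    using real_arch_simple by blast
  have nonneg: "8 * B / \<epsilon> \<ge> 0" "8 * M / \<epsilon>\<^sup>2 \<ge> 0" "4 / \<epsilon>\<^sup>2 \<ge> 0"
    using \<open>B \<ge> 0\<close> \<open>M \<ge> 0\<close> assms(12) by auto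
  have "n \<ge> N" "n > 0"
    using n nonneg by linarith+
  have "8 * B / \<epsilon> \<le> real n" "8 * M / \<epsilon>\<^sup>2 \<le> real n" "4 / \<epsilon>\<^sup>2 \<le> real n"
    using n nonneg by linarith+
  then have nB: "8 * B \<le> \<epsilon> * real n" and nM: "8 * M \<le> \<epsilon>\<^sup>2 * real n" and n4: "4 \<le> \<epsilon>\<^sup>2 * real n"
    using assms(12) by (simp_all add: field_simps)
  have two: "2 \<le> \<epsilon> * sqrt (real n)"
    by (rule power2_le_imp_le) (use n4 assms(12) in \<open>auto simp: power_mult_distrib\<close>)
  obtain w where inj: "inj_on (\<lambda>(g, i). \<sigma> g (w i)) (F' \<times> {1..2*n})"
    and disc: "(\<Sum>a\<in>A. (cmod (\<Sum>i=1..2*n. apply_bcontfun a (w i) - \<phi> a))\<^sup>2) \<le> M * real (2 * n)"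
    using generic_points_with_small_discrepancy[OF assms(1,2,4,5) no_isolated F'(1,2) assms(8,9), of "2*n"]
    unfolding M_def by blast
  define Nb where "Nb = (\<lambda>i. \<Inter>a\<in>A. {x. cmod (apply_bcontfun a x - apply_bcontfun a (w i)) < \<epsilon> / 4})"
  have Nb: "open (Nb i) \<and> w i \<in> Nb i" for i
    unfolding Nb_def using assms(9,12)
    by (auto intro!: open_INT open_Collect_less continuous_intros)
  obtain W where W': "\<forall>i\<in>{1..2*n}. open (W i) \<and> w i \<in> W i \<and> W i \<subseteq> Nb i"
    and W_disj: "disjoint_family_on (\<lambda>(g, i). \<sigma> g ` W i) (F' \<times> {1..2*n})"
    using disjoint_translates[OF assms(1,4) F'(1,2) finite_atLeastAtMost inj Nb]
    by (elim exE conjE) (rule that)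
  then have W: "open (W i) \<and> w i \<in> W i \<and> W i \<subseteq> Nb i" if "i \<in> {1..2*n}" for i
    using that by blast
  define U where "U = (\<lambda>i. W (n + i))"
  have "\<exists>g\<in>K. \<sigma> g ` (UNIV - U i) \<subseteq> W i" if "i \<in> {1..n}" for i
    using that W[of i] W[of "n + i"] unfolding U_def by (intro ep) auto
  then obtain t where t: "\<And>i. i \<in> {1..n} \<Longrightarrow> t i \<in> K \<and> \<sigma> (t i) ` (UNIV - U i) \<subseteq> W i"
    by metis
  have one: "\<sigma> \<one>\<^bsub>G\<^esub> x = x" for x
    using act(1,2)[of "\<one>\<^bsub>G\<^esub>"] by simp
  have "disjoint_family_on W {1..2*n}"
    unfolding disjoint_family_on_def
  proof (intro ballI impI)
    fix i j assume "i \<in> {1..2*n}" "j \<in> {1..2*n}" "i \<noteq> j"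
    then show "W i \<inter> W j = {}"
      using disjoint_family_onD[OF W_disj, of "(\<one>\<^bsub>G\<^esub>, i)" "(\<one>\<^bsub>G\<^esub>, j)"] F'(3) by (simp add: one)
  qed
  then have disj: "disjoint_family_on U {1..n}" "disjoint_family_on W {1..n}"
    by (auto simp: disjoint_family_on_def U_def)
  have disj': "disjoint_family_on (case_sum (\<lambda>(g, i). \<sigma> g ` W i) (\<lambda>(h, j). \<sigma> h ` U j))
      ((F \<times> {1..n}) <+> (F \<times> {1..n}))"
    unfolding disjoint_family_on_def
  proof (intro ballI impI)
    \<comment> \<open>\<open>\<rho>\<close> identifies the two copies of \<open>F \<times> {1..n}\<close> with disjoint parts of \<open>F' \<times> {1..2n}\<close>.\<close>
    define \<rho> where "\<rho> = case_sum (\<lambda>p. p) (\<lambda>(h :: 'g, j). (h, n + j))"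
    have eq: "case_sum (\<lambda>(g, i). \<sigma> g ` W i) (\<lambda>(h, j). \<sigma> h ` U j) s = (\<lambda>(g, i). \<sigma> g ` W i) (\<rho> s)" for s
      by (auto simp: \<rho>_def U_def split: sum.split)
    fix r s assume rs: "r \<in> (F \<times> {1..n}) <+> (F \<times> {1..n})" "s \<in> (F \<times> {1..n}) <+> (F \<times> {1..n})" "r \<noteq> s"
    then have "\<rho> r \<in> F' \<times> {1..2*n}" "\<rho> s \<in> F' \<times> {1..2*n}" "\<rho> r \<noteq> \<rho> s"
      using F'(4) by (auto simp: \<rho>_def)
    then show "case_sum (\<lambda>(g, i). \<sigma> g ` W i) (\<lambda>(h, j). \<sigma> h ` U j) r
        \<inter> case_sum (\<lambda>(g, i). \<sigma> g ` W i) (\<lambda>(h, j). \<sigma> h ` U j) s = {}"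
      unfolding eq by (rule disjoint_family_onD[OF W_disj])
  qed
  have avg: "norm ((1 / (2 * real n)) *\<^sub>R (\<Sum>i=1..n. induced_action G \<sigma> (t i) a
      + inv_into UNIV (induced_action G \<sigma> (t i)) a) - \<phi> a *\<^sub>C 1) < \<epsilon>" if a: "a \<in> A" for a
  proof -
    have close: "cmod (apply_bcontfun a x - apply_bcontfun a (w i)) \<le> \<epsilon> / 4"
      if "i \<in> {1..2*n}" "x \<in> W i" for i x
    proof -
      have "x \<in> Nb i"
        using W[OF that(1)] that(2) by blast
      then show ?thesis
        using a unfolding Nb_def by (auto dest: less_imp_le)
    qed
    have "(cmod (\<Sum>i=1..2*n. apply_bcontfun a (w i) - \<phi> a))\<^sup>2
        \<le> (\<Sum>a\<in>A. (cmod (\<Sum>i=1..2*n. apply_bcontfun a (w i) - \<phi> a))\<^sup>2)"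
      using a assms(9) by (intro member_le_sum) auto
    also have "\<dots> \<le> M * real (2 * n)" by (rule disc)
    also have "\<dots> \<le> (\<epsilon> * real n / 2)\<^sup>2"
      using mult_right_mono[OF nM, of "real n / 4"] by (simp add: power2_eq_square mult_ac)
    finally have S: "cmod (\<Sum>i=1..2*n. apply_bcontfun a (w i) - \<phi> a) \<le> \<epsilon> * real n / 2"
      by (rule power2_le_imp_le) (use assms(12) in auto)
    have "(\<Sum>i=1..2*n. apply_bcontfun a (w i) - \<phi> a)
        = (\<Sum>i=1..n. apply_bcontfun a (w i) - \<phi> a) + (\<Sum>i=n+1..n+n. apply_bcontfun a (w i) - \<phi> a)"
      using sum.ub_add_nat[of 1 n "\<lambda>i. apply_bcontfun a (w i) - \<phi> a" n] by (simp add: mult_2)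
    also have "(\<Sum>i=n+1..n+n. apply_bcontfun a (w i) - \<phi> a) = (\<Sum>i=1..n. apply_bcontfun a (w (n + i)) - \<phi> a)"
      using sum.shift_bounds_cl_nat_ivl[of "\<lambda>i. apply_bcontfun a (w i) - \<phi> a" 1 n n]
      by (simp add: add.commute)
    finally have S': "cmod (\<Sum>i=1..n. (apply_bcontfun a (w (n + i)) - \<phi> a) + (apply_bcontfun a (w i) - \<phi> a))
        \<le> \<epsilon> * real n / 2"
      using S by (simp only: sum.distrib add.commute)
    have "norm ((1 / (2 * real n)) *\<^sub>R (\<Sum>i=1..n. induced_action G \<sigma> (t i) a
        + inv_into UNIV (induced_action G \<sigma> (t i)) a) - \<phi> a *\<^sub>C 1)
      \<le> \<epsilon> / 4 + 2 * norm a / real n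
        + cmod (\<Sum>i=1..n. (apply_bcontfun a (w (n + i)) - \<phi> a) + (apply_bcontfun a (w i) - \<phi> a)) / (2 * real n)"
      using t K close \<open>n > 0\<close> assms(12) disj
      by (intro north_south_average[OF assms(1,4), where U = U and V = W]) (auto simp: U_def)
    also have "\<dots> \<le> \<epsilon> / 4 + \<epsilon> / 4 + \<epsilon> / 4"
      using B[OF a] nB S' \<open>n > 0\<close> by (intro add_mono) (auto simp: field_simps)
    also have "\<dots> < \<epsilon>"
      using assms(12) by simp
    finally show ?thesis .
  qed
  have "PHP_witness G (induced_action G \<sigma>) \<phi> A F \<epsilon> n t
      (\<lambda>i. {g \<in> carrier G. \<sigma> g undefined \<in> W i}) (\<lambda>i. {g \<in> carrier G. \<sigma> g undefined \<in> W i})"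
    using t K by (intro PHP_witness_return_sets[OF assms(1,4,11) _ disj disj' two avg]) auto
  then show ?thesis
    using \<open>n \<ge> N\<close> t by blast
qed

theorem theorem2p3:
  fixes G :: "('g, 'm) monoid_scheme"
    and \<sigma> :: "'g \<Rightarrow> 'x::t2_space \<Rightarrow> 'x"
  assumes "group G"
    and "compact (UNIV :: 'x set)"
    and "infinite (UNIV :: 'x set) \<or> card (UNIV :: 'x set) > 2"
    and "topological_action G \<sigma>"
    and "extremely_proximal G \<sigma>"
    and "topologically_free G \<sigma>"
  shows "(\<forall>\<phi>. state \<phi> \<longrightarrow> PHP G (induced_action G \<sigma>) \<phi>) \<and>
    (\<forall>K. subgroup K G \<and> extremely_proximal (G\<lparr>carrier := K\<rparr>) \<sigma> \<longrightarrow>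
      (\<forall>\<phi>. state \<phi> \<longrightarrow> PHP_relative G K (induced_action G \<sigma>) \<phi>))"
proof -
  have relative: "PHP_relative G K (induced_action G \<sigma>) \<phi>"
    if "subgroup K G" "extremely_proximal (G\<lparr>carrier := K\<rparr>) \<sigma>" "state \<phi>" for K \<phi>
    unfolding PHP_relative_def
  proof (intro conjI allI impI ballI)
    fix A :: "('x \<Rightarrow>\<^sub>C complex) set" and F N and \<epsilon> :: real
    assume "finite A \<and> finite F \<and> F \<subseteq> carrier G \<and> \<epsilon> > 0"
    then show "\<exists>n\<ge>N. \<exists>t C D. PHP_witness G (induced_action G \<sigma>) \<phi> A F \<epsilon> n t C D
        \<and> (\<forall>i\<in>{1..n}. t i \<in> K)"
      by (elim conjE) (rule exists_PHP_witness_in_subgroup[OF assms(1-4,6) that])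
  qed (use that assms(1) star_automorphism_induced_action[OF assms(4)] in simp_all)
  have "PHP G (induced_action G \<sigma>) \<phi>" if "state \<phi>" for \<phi>
  proof -
    have "PHP_relative G (carrier G) (induced_action G \<sigma>) \<phi>"
      using assms(5) that by (intro relative group.subgroup_self[OF assms(1)]) auto
    then show ?thesis
      unfolding PHP_relative_def PHP_def by meson
  qed
  with relative show ?thesis by blast
qed

end
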